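(* Let $K$ be a field, $\lambda\in K$, and let $(A,\mu,\Delta,\alpha,\beta,\psi,\omega)$ be a $\lambda$-infBH-bialgebra. Then $\mathfrak D=\mu\circ\Delta:A\to A$ is a $\lambda$-$(\alpha\omega,\beta\psi)$-derivation, i.e. $$\mathfrak D(ab)=\alpha\omega(a)\,\mathfrak D(b)+\mathfrak D(a)\,\beta\psi(b)+\lambda\,\alpha\omega(a)\,\beta\psi(b)\qquad\text{for all }a,b\in A.$$
   Context: BiHom-associative algebra $(A,\mu,\alpha,\beta)$: a $K$-vector space with linear $\mu$ (written $ab$), $\alpha,\beta:A\to A$ with $\alpha\beta=\beta\alpha$, $\alpha,\beta$ multiplicative, $\alpha(a)(bc)=(ab)\beta(c)$. BiHom-coassociative coalgebra $(A,\Delta,\psi,\omega)$: $\psi\omega=\omega\psi$, $(\psi\otimes\psi)\Delta=\Delta\psi$, $(\omega\otimes\omega)\Delta=\Delta\omega$, $(\Delta\otimes\psi)\Delta=(\omega\otimes\Delta)\Delta$. $\lambda$-infBH-bialgebra $(A,\mu,\Delta,\alpha,\beta,\psi,\omega)$: $(A,\mu,\alpha,\beta)$ is BiHom-associative, $(A,\Delta,\psi,\omega)$ is BiHom-coassociative, each of $\alpha,\beta$ commutes with each of $\psi,\omega$, $(\alpha\otimes\alpha)\Delta=\Delta\alpha$, $(\beta\otimes\beta)\Delta=\Delta\beta$, $\psi,\omega$ are multiplicative, and (with $\Delta(a)=a_1\otimes a_2$) $\Delta(ab)=\omega(a)b_1\otimes\beta(b_2)+\alpha(a_1)\otimes a_2\psi(b)+\lambda\,\alpha\omega(a)\otimes\beta\psi(b)$.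 For algebra maps (multiplicative linear maps) $\xi,\zeta:A\to A$, a $\lambda$-$(\xi,\zeta)$-derivation is a linear map $\mathfrak D$ with $\mathfrak D(ab)=\xi(a)\mathfrak D(b)+\mathfrak D(a)\zeta(b)+\lambda\xi(a)\zeta(b)$. *)

theory Defs
  imports "Jordan_Normal_Form.Missing_VectorSpace" "HOL-Algebra.AbelCoset"
begin

subsection \<open>Tensor products of vector spaces\<close>

text \<open>
  The record type of modules extends that of rings, so each vector space below carries
  meaningless \<open>mult\<close> and \<open>one\<close> fields, which are left undefined.
\<close>

definition free_space :: "('k, 'm) ring_scheme \<Rightarrow> 'x set \<Rightarrow> ('k, 'x \<Rightarrow> 'k) module" where
  "free_space K X =
    \<lparr>carrier = {f. (\<forall>x\<in>X. f x \<in> carrier K) \<and> (\<forall>x. x \<notin> X \<longrightarrow> f x = \<zero>\<^bsub>K\<^esub>) \<and> finite {x. f x \<noteq> \<zero>\<^bsub>K\<^esub>}},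
     mult = undefined, one = undefined,
     zero = (\<lambda>x. \<zero>\<^bsub>K\<^esub>),
     add = (\<lambda>f g x. f x \<oplus>\<^bsub>K\<^esub> g x),
     smult = (\<lambda>c f x. c \<otimes>\<^bsub>K\<^esub> f x)\<rparr>"

definition free_gen :: "('k, 'm) ring_scheme \<Rightarrow> 'x \<Rightarrow> 'x \<Rightarrow> 'k" where
  "free_gen K x = (\<lambda>y. if y = x then \<one>\<^bsub>K\<^esub> else \<zero>\<^bsub>K\<^esub>)"

definition quotient_space :: "('k, 'v, 'n) module_scheme \<Rightarrow> 'v set \<Rightarrow> ('k, 'v set) module" where
  "quotient_space V H =
    \<lparr>carrier = a_rcosets\<^bsub>V\<^esub> H,
     mult = undefined, one = undefined,
     zero = H,
     add = set_add V,
     smult = (\<lambda>c X. \<Union>x\<in>X. H +>\<^bsub>V\<^esub> (c \<odot>\<^bsub>V\<^esub> x))\<rparr>"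

definition tensor_relations ::
  "('k, 'm) ring_scheme \<Rightarrow> ('k, 'v, 'n) module_scheme \<Rightarrow> ('k, 'w, 'p) module_scheme \<Rightarrow> ('v \<times> 'w \<Rightarrow> 'k) set" where
  "tensor_relations K V W = (let F = free_space K (carrier V \<times> carrier W) in
     {free_gen K (x \<oplus>\<^bsub>V\<^esub> x', y) \<ominus>\<^bsub>F\<^esub> (free_gen K (x, y) \<oplus>\<^bsub>F\<^esub> free_gen K (x', y)) | x x' y.
        x \<in> carrier V \<and> x' \<in> carrier V \<and> y \<in> carrier W} \<union>
     {free_gen K (x, y \<oplus>\<^bsub>W\<^esub> y') \<ominus>\<^bsub>F\<^esub> (free_gen K (x, y) \<oplus>\<^bsub>F\<^esub> free_gen K (x, y')) | x y y'.
        x \<in> carrier V \<and> y \<in> carrier W \<and> y' \<in> carrier W} \<union>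
     {free_gen K (c \<odot>\<^bsub>V\<^esub> x, y) \<ominus>\<^bsub>F\<^esub> c \<odot>\<^bsub>F\<^esub> free_gen K (x, y) | c x y.
        c \<in> carrier K \<and> x \<in> carrier V \<and> y \<in> carrier W} \<union>
     {free_gen K (x, c \<odot>\<^bsub>W\<^esub> y) \<ominus>\<^bsub>F\<^esub> c \<odot>\<^bsub>F\<^esub> free_gen K (x, y) | c x y.
        c \<in> carrier K \<and> x \<in> carrier V \<and> y \<in> carrier W})"

definition tensor_null ::
  "('k, 'm) ring_scheme \<Rightarrow> ('k, 'v, 'n) module_scheme \<Rightarrow> ('k, 'w, 'p) module_scheme \<Rightarrow> ('v \<times> 'w \<Rightarrow> 'k) set" where
  "tensor_null K V W =
     LinearCombinations.module.span K (free_space K (carrier V \<times> carrier W)) (tensor_relations K V W)"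

definition tensor_space ::
  "('k, 'm) ring_scheme \<Rightarrow> ('k, 'v, 'n) module_scheme \<Rightarrow> ('k, 'w, 'p) module_scheme
    \<Rightarrow> ('k, ('v \<times> 'w \<Rightarrow> 'k) set) module" where
  "tensor_space K V W = quotient_space (free_space K (carrier V \<times> carrier W)) (tensor_null K V W)"

definition pure_tensor ::
  "('k, 'm) ring_scheme \<Rightarrow> ('k, 'v, 'n) module_scheme \<Rightarrow> ('k, 'w, 'p) module_scheme
    \<Rightarrow> 'v \<Rightarrow> 'w \<Rightarrow> ('v \<times> 'w \<Rightarrow> 'k) set" where
  "pure_tensor K V W x y =
     tensor_null K V W +>\<^bsub>free_space K (carrier V \<times> carrier W)\<^esub> free_gen K (x, y)"

text \<open>
  For a bilinear \<open>b\<close> with values in \<open>U\<close>, the induced linear map on the tensor product evaluates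
  \<open>b\<close> on any representative of a class; the image of the class is then a singleton.
\<close>

definition tensor_lift ::
  "('k, 'm) ring_scheme \<Rightarrow> ('k, 'u, 'n) module_scheme \<Rightarrow> ('v \<Rightarrow> 'w \<Rightarrow> 'u)
    \<Rightarrow> ('v \<times> 'w \<Rightarrow> 'k) set \<Rightarrow> 'u" where
  "tensor_lift K U b X =
     the_elem ((\<lambda>f. \<Oplus>\<^bsub>U\<^esub>p\<in>{p. f p \<noteq> \<zero>\<^bsub>K\<^esub>}. f p \<odot>\<^bsub>U\<^esub> b (fst p) (snd p)) ` X)"

text \<open>\<open>tensor_map K V W f g\<close> is \<open>f \<otimes> g\<close>, where \<open>V\<close> and \<open>W\<close> are the codomains of \<open>f\<close> and \<open>g\<close>.\<close>

definition tensor_map ::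
  "('k, 'm) ring_scheme \<Rightarrow> ('k, 'v, 'n) module_scheme \<Rightarrow> ('k, 'w, 'p) module_scheme
    \<Rightarrow> ('x \<Rightarrow> 'v) \<Rightarrow> ('y \<Rightarrow> 'w) \<Rightarrow> ('x \<times> 'y \<Rightarrow> 'k) set \<Rightarrow> ('v \<times> 'w \<Rightarrow> 'k) set" where
  "tensor_map K V W f g = tensor_lift K (tensor_space K V W) (\<lambda>x y. pure_tensor K V W (f x) (g y))"

text \<open>The canonical isomorphism \<open>(U \<otimes> V) \<otimes> W \<rightarrow> U \<otimes> (V \<otimes> W)\<close>.\<close>

definition tensor_assoc ::
  "('k, 'm) ring_scheme \<Rightarrow> ('k, 'u, 'n) module_scheme \<Rightarrow> ('k, 'v, 'p) module_scheme
    \<Rightarrow> ('k, 'w, 'q) module_scheme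
    \<Rightarrow> (('u \<times> 'v \<Rightarrow> 'k) set \<times> 'w \<Rightarrow> 'k) set \<Rightarrow> ('u \<times> ('v \<times> 'w \<Rightarrow> 'k) set \<Rightarrow> 'k) set" where
  "tensor_assoc K U V W =
     tensor_lift K (tensor_space K U (tensor_space K V W))
       (\<lambda>X z. tensor_lift K (tensor_space K U (tensor_space K V W))
          (\<lambda>x y. pure_tensor K U (tensor_space K V W) x (pure_tensor K V W y z)) X)"


subsection \<open>BiHom-associative algebras and BiHom-coassociative coalgebras\<close>

definition alg_prod ::
  "('k, 'm) ring_scheme \<Rightarrow> ('k, 'a, 'n) module_scheme \<Rightarrow> (('a \<times> 'a \<Rightarrow> 'k) set \<Rightarrow> 'a) \<Rightarrow> 'a \<Rightarrow> 'a \<Rightarrow> 'a" where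
  "alg_prod K A \<mu> a b = \<mu> (pure_tensor K A A a b)"

definition multiplicative ::
  "('k, 'm) ring_scheme \<Rightarrow> ('k, 'a, 'n) module_scheme \<Rightarrow> (('a \<times> 'a \<Rightarrow> 'k) set \<Rightarrow> 'a)
    \<Rightarrow> ('a \<Rightarrow> 'a) \<Rightarrow> bool" where
  "multiplicative K A \<mu> \<xi> \<longleftrightarrow>
     (\<forall>a\<in>carrier A. \<forall>b\<in>carrier A. \<xi> (alg_prod K A \<mu> a b) = alg_prod K A \<mu> (\<xi> a) (\<xi> b))"

definition algebra_map ::
  "('k, 'm) ring_scheme \<Rightarrow> ('k, 'a, 'n) module_scheme \<Rightarrow> (('a \<times> 'a \<Rightarrow> 'k) set \<Rightarrow> 'a)
    \<Rightarrow> ('a \<Rightarrow> 'a) \<Rightarrow> bool" where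
  "algebra_map K A \<mu> \<xi> \<longleftrightarrow> \<xi> \<in> module_hom K A A \<and> multiplicative K A \<mu> \<xi>"

locale bihom_associative_algebra = vectorspace K A
  for K :: "('k, 'm) ring_scheme" and A :: "('k, 'a, 'n) module_scheme" +
  fixes \<mu> :: "('a \<times> 'a \<Rightarrow> 'k) set \<Rightarrow> 'a" and \<alpha> \<beta> :: "'a \<Rightarrow> 'a"
  assumes \<mu>_linear: "\<mu> \<in> module_hom K (tensor_space K A A) A"
    and \<alpha>_linear: "\<alpha> \<in> module_hom K A A"
    and \<beta>_linear: "\<beta> \<in> module_hom K A A"
    and \<alpha>_\<beta>: "a \<in> carrier A \<Longrightarrow> \<alpha> (\<beta> a) = \<beta> (\<alpha> a)"
    and \<alpha>_multiplicative: "multiplicative K A \<mu> \<alpha>"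
    and \<beta>_multiplicative: "multiplicative K A \<mu> \<beta>"
    and bihom_assoc: "\<lbrakk>a \<in> carrier A; b \<in> carrier A; c \<in> carrier A\<rbrakk> \<Longrightarrow>
      alg_prod K A \<mu> (\<alpha> a) (alg_prod K A \<mu> b c) = alg_prod K A \<mu> (alg_prod K A \<mu> a b) (\<beta> c)"

locale bihom_coassociative_coalgebra = vectorspace K A
  for K :: "('k, 'm) ring_scheme" and A :: "('k, 'a, 'n) module_scheme" +
  fixes \<Delta> :: "'a \<Rightarrow> ('a \<times> 'a \<Rightarrow> 'k) set" and \<psi> \<omega> :: "'a \<Rightarrow> 'a"
  assumes \<Delta>_linear: "\<Delta> \<in> module_hom K A (tensor_space K A A)"
    and \<psi>_linear: "\<psi> \<in> module_hom K A A"
    and \<omega>_linear: "\<omega> \<in> module_hom K A A"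
    and \<psi>_\<omega>: "a \<in> carrier A \<Longrightarrow> \<psi> (\<omega> a) = \<omega> (\<psi> a)"
    and \<psi>_comultiplicative: "a \<in> carrier A \<Longrightarrow> tensor_map K A A \<psi> \<psi> (\<Delta> a) = \<Delta> (\<psi> a)"
    and \<omega>_comultiplicative: "a \<in> carrier A \<Longrightarrow> tensor_map K A A \<omega> \<omega> (\<Delta> a) = \<Delta> (\<omega> a)"
    and bihom_coassoc: "a \<in> carrier A \<Longrightarrow>
      tensor_assoc K A A A (tensor_map K (tensor_space K A A) A \<Delta> \<psi> (\<Delta> a)) =
      tensor_map K A (tensor_space K A A) \<omega> \<Delta> (\<Delta> a)"


subsection \<open>Infinitesimal BiHom-bialgebras of weight \<open>\<lambda>\<close>\<close>

text \<open>
  In \<open>\<Delta>_prod\<close> the Sweedler terms \<open>\<omega>(a)b\<^sub>1 \<otimes> \<beta>(b\<^sub>2)\<close> and \<open>\<alpha>(a\<^sub>1) \<otimes> a\<^sub>2\<psi>(b)\<close> are the values at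
  \<open>\<Delta>(b)\<close> and \<open>\<Delta>(a)\<close> of \<open>L \<otimes> \<beta>\<close> and \<open>\<alpha> \<otimes> R\<close>, with \<open>L\<close> left multiplication by \<open>\<omega>(a)\<close> and
  \<open>R\<close> right multiplication by \<open>\<psi>(b)\<close>.
\<close>

locale inf_bihom_bialgebra =
  bihom_associative_algebra K A \<mu> \<alpha> \<beta> + bihom_coassociative_coalgebra K A \<Delta> \<psi> \<omega>
  for K :: "('k, 'm) ring_scheme" and A :: "('k, 'a, 'n) module_scheme"
    and lam :: 'k and \<mu> \<Delta> \<alpha> \<beta> \<psi> \<omega> +
  assumes \<alpha>_\<psi>: "a \<in> carrier A \<Longrightarrow> \<alpha> (\<psi> a) = \<psi> (\<alpha> a)"
    and \<alpha>_\<omega>: "a \<in> carrier A \<Longrightarrow> \<alpha> (\<omega> a) = \<omega> (\<alpha> a)"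
    and \<beta>_\<psi>: "a \<in> carrier A \<Longrightarrow> \<beta> (\<psi> a) = \<psi> (\<beta> a)"
    and \<beta>_\<omega>: "a \<in> carrier A \<Longrightarrow> \<beta> (\<omega> a) = \<omega> (\<beta> a)"
    and \<alpha>_comultiplicative: "a \<in> carrier A \<Longrightarrow> tensor_map K A A \<alpha> \<alpha> (\<Delta> a) = \<Delta> (\<alpha> a)"
    and \<beta>_comultiplicative: "a \<in> carrier A \<Longrightarrow> tensor_map K A A \<beta> \<beta> (\<Delta> a) = \<Delta> (\<beta> a)"
    and \<psi>_multiplicative: "multiplicative K A \<mu> \<psi>"
    and \<omega>_multiplicative: "multiplicative K A \<mu> \<omega>"
    and \<Delta>_prod: "\<lbrakk>a \<in> carrier A; b \<in> carrier A\<rbrakk> \<Longrightarrow>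
      \<Delta> (alg_prod K A \<mu> a b) =
        tensor_map K A A (\<lambda>x. alg_prod K A \<mu> (\<omega> a) x) \<beta> (\<Delta> b)
        \<oplus>\<^bsub>tensor_space K A A\<^esub> tensor_map K A A \<alpha> (\<lambda>y. alg_prod K A \<mu> y (\<psi> b)) (\<Delta> a)
        \<oplus>\<^bsub>tensor_space K A A\<^esub>
          lam \<odot>\<^bsub>tensor_space K A A\<^esub> pure_tensor K A A (\<alpha> (\<omega> a)) (\<beta> (\<psi> b))"

definition weighted_derivation ::
  "('k, 'm) ring_scheme \<Rightarrow> ('k, 'a, 'n) module_scheme \<Rightarrow> (('a \<times> 'a \<Rightarrow> 'k) set \<Rightarrow> 'a) \<Rightarrow> 'k
    \<Rightarrow> ('a \<Rightarrow> 'a) \<Rightarrow> ('a \<Rightarrow> 'a) \<Rightarrow> ('a \<Rightarrow> 'a) \<Rightarrow> bool" where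
  "weighted_derivation K A \<mu> lam \<xi> \<zeta> D \<longleftrightarrow>
     algebra_map K A \<mu> \<xi> \<and> algebra_map K A \<mu> \<zeta> \<and> D \<in> module_hom K A A \<and>
     (\<forall>a\<in>carrier A. \<forall>b\<in>carrier A.
        D (alg_prod K A \<mu> a b) =
          alg_prod K A \<mu> (\<xi> a) (D b) \<oplus>\<^bsub>A\<^esub> alg_prod K A \<mu> (D a) (\<zeta> b)
          \<oplus>\<^bsub>A\<^esub> lam \<odot>\<^bsub>A\<^esub> alg_prod K A \<mu> (\<xi> a) (\<zeta> b))"

end

theory Submission
  imports Defs
begin

text \<open>
  Applying \<open>\<mu>\<close> to the compatibility formula for \<open>\<Delta>(ab)\<close> reduces the claim to
  \<open>\<mu> \<circ> (L \<otimes> \<beta>) = L' \<circ> \<mu>\<close>, with \<open>L\<close>, \<open>L'\<close> left multiplication by \<open>c\<close>, \<open>\<alpha>(c)\<close>, and to the mirror image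
  for right multiplications. Both sides are linear on \<open>A \<otimes> A\<close>, and on \<open>x \<otimes> y\<close> the identity is
  BiHom-associativity \<open>(cx)\<beta>(y) = \<alpha>(c)(xy)\<close>. A linear map on a tensor product is determined by
  its values on pure tensors.
\<close>

subsection \<open>Linear maps\<close>

lemma module_homI:
  assumes "\<And>x. x \<in> carrier M \<Longrightarrow> f x \<in> carrier N"
    and "\<And>x y. \<lbrakk>x \<in> carrier M; y \<in> carrier M\<rbrakk> \<Longrightarrow> f (x \<oplus>\<^bsub>M\<^esub> y) = f x \<oplus>\<^bsub>N\<^esub> f y"
    and "\<And>c x. \<lbrakk>c \<in> carrier R; x \<in> carrier M\<rbrakk> \<Longrightarrow> f (c \<odot>\<^bsub>M\<^esub> x) = c \<odot>\<^bsub>N\<^esub> f x"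
  shows "f \<in> module_hom R M N"
  using assms unfolding module_hom_def by auto

lemma module_hom_in_carrier:
  "\<lbrakk>f \<in> module_hom R M N; x \<in> carrier M\<rbrakk> \<Longrightarrow> f x \<in> carrier N"
  by (auto simp: module_hom_def)

lemmas module_hom_simps = module_hom_in_carrier module_hom_add module_hom_smult

lemma module_hom_comp:
  assumes "f \<in> module_hom R M N" and "g \<in> module_hom R N L"
  shows "g \<circ> f \<in> module_hom R M L"
  by (rule module_homI) (simp_all add: module_hom_simps[OF assms(1)] module_hom_simps[OF assms(2)])

lemma module_hom_zero:
  assumes "module R M" and "module R N" and "f \<in> module_hom R M N"
  shows "f \<zero>\<^bsub>M\<^esub> = \<zero>\<^bsub>N\<^esub>"
proof -
  interpret mod_hom R M N f
    using assms by (intro mod_hom.intro mod_hom_axioms.intro)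
  show ?thesis by simp
qed

text \<open>\<open>module_hom\<close> speaks of sums and scalar multiples only. Negation is scaling
  by \<open>- 1\<close>, so homogeneity carries it through \<open>f\<close>.\<close>

lemma module_hom_minus:
  assumes "module R M" and "module R N" and f: "f \<in> module_hom R M N"
    and x: "x \<in> carrier M" and y: "y \<in> carrier M"
  shows "f (x \<ominus>\<^bsub>M\<^esub> y) = f x \<ominus>\<^bsub>N\<^esub> f y"
proof -
  interpret M: module R M by fact
  interpret N: module R N by fact
  note fy = module_hom_in_carrier[OF f y]
  have "f (\<ominus>\<^bsub>M\<^esub> y) = f ((\<ominus>\<^bsub>R\<^esub> \<one>\<^bsub>R\<^esub>) \<odot>\<^bsub>M\<^esub> y)"
    using y by (simp add: M.smult_l_minus)
  also have "\<dots> = (\<ominus>\<^bsub>R\<^esub> \<one>\<^bsub>R\<^esub>) \<odot>\<^bsub>N\<^esub> f y"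
    using y by (intro module_hom_smult[OF f]) auto
  also have "\<dots> = \<ominus>\<^bsub>N\<^esub> f y"
    using fy by (simp add: N.smult_l_minus)
  finally show ?thesis
    using x y by (simp add: a_minus_def module_hom_add[OF f])
qed

subsection \<open>Free modules\<close>

lemma free_space_simps [simp]:
  "\<zero>\<^bsub>free_space K X\<^esub> = (\<lambda>x. \<zero>\<^bsub>K\<^esub>)"
  "f \<oplus>\<^bsub>free_space K X\<^esub> g = (\<lambda>x. f x \<oplus>\<^bsub>K\<^esub> g x)"
  "c \<odot>\<^bsub>free_space K X\<^esub> f = (\<lambda>x. c \<otimes>\<^bsub>K\<^esub> f x)"
  by (simp_all add: free_space_def)

lemma free_space_carrier:
  "f \<in> carrier (free_space K X) \<longleftrightarrow>
    (\<forall>x\<in>X. f x \<in> carrier K) \<and> (\<forall>x. x \<notin> X \<longrightarrow> f x = \<zero>\<^bsub>K\<^esub>) \<and> finite {x. f x \<noteq> \<zero>\<^bsub>K\<^esub>}"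
  by (simp add: free_space_def)

lemma free_space_coeff:
  assumes "cring K" and "f \<in> carrier (free_space K X)"
  shows "f x \<in> carrier K"
proof -
  interpret cring K by fact
  show ?thesis using assms(2) by (cases "x \<in> X") (auto simp: free_space_carrier)
qed

lemma module_free_space:
  assumes "cring K"
  shows "module K (free_space K X)"
proof -
  interpret cring K by fact
  note coeff = free_space_coeff[OF assms, of _ X]
  have add: "(\<lambda>x. f x \<oplus>\<^bsub>K\<^esub> g x) \<in> carrier (free_space K X)"
    if "f \<in> carrier (free_space K X)" "g \<in> carrier (free_space K X)" for f g
  proof -
    have "{x. f x \<oplus>\<^bsub>K\<^esub> g x \<noteq> \<zero>\<^bsub>K\<^esub>} \<subseteq> {x. f x \<noteq> \<zero>\<^bsub>K\<^esub>} \<union> {x. g x \<noteq> \<zero>\<^bsub>K\<^esub>}" by auto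
    with that show ?thesis by (auto simp: free_space_carrier intro: finite_subset)
  qed
  have smult: "(\<lambda>x. c \<otimes>\<^bsub>K\<^esub> f x) \<in> carrier (free_space K X)"
    if "c \<in> carrier K" "f \<in> carrier (free_space K X)" for c f
  proof -
    have "{x. c \<otimes>\<^bsub>K\<^esub> f x \<noteq> \<zero>\<^bsub>K\<^esub>} \<subseteq> {x. f x \<noteq> \<zero>\<^bsub>K\<^esub>}" using that by auto
    with that show ?thesis by (auto simp: free_space_carrier intro: finite_subset)
  qed
  \<comment> \<open>The additive inverse is taken as the multiple by \<open>- 1\<close>, so that its
    finite support comes from \<open>smult\<close>.\<close>
  have neg: "\<exists>g\<in>carrier (free_space K X). (\<lambda>x. f x \<oplus>\<^bsub>K\<^esub> g x) = (\<lambda>x. \<zero>\<^bsub>K\<^esub>)"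
    if f: "f \<in> carrier (free_space K X)" for f
    using smult[OF _ f, of "\<ominus>\<^bsub>K\<^esub> \<one>\<^bsub>K\<^esub>"] coeff[OF f]
    by (intro bexI[of _ "\<lambda>x. \<ominus>\<^bsub>K\<^esub> \<one>\<^bsub>K\<^esub> \<otimes>\<^bsub>K\<^esub> f x"]) (auto simp: l_minus r_neg)
  show ?thesis
    by (rule module_criteria)
       (use add smult neg coeff in \<open>auto simp: is_cring free_space_carrier[of "\<lambda>x. \<zero>\<^bsub>K\<^esub>"]
         fun_eq_iff add.m_lcomm a_comm a_assoc m_assoc l_distr r_distr\<close>)
qed

lemma free_gen_closed:
  assumes "cring K" and "x \<in> X"
  shows "free_gen K x \<in> carrier (free_space K X)"
proof -
  interpret cring K by fact
  have "{y. free_gen K x y \<noteq> \<zero>\<^bsub>K\<^esub>} \<subseteq> {x}" by (auto simp: free_gen_def)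
  then show ?thesis
    using assms(2) by (auto simp: free_space_carrier free_gen_def intro: finite_subset)
qed

text \<open>A finitely supported function is a finite sum of multiples of generators, so it is
  reached from zero by adding one such multiple at a time.\<close>

lemma free_space_induct [consumes 2, case_names zero add]:
  assumes K: "cring K" and f: "f \<in> carrier (free_space K X)"
    and zero: "P \<zero>\<^bsub>free_space K X\<^esub>"
    and add: "\<And>f c x. \<lbrakk>f \<in> carrier (free_space K X); P f; c \<in> carrier K; x \<in> X\<rbrakk> \<Longrightarrow>
      P (f \<oplus>\<^bsub>free_space K X\<^esub> c \<odot>\<^bsub>free_space K X\<^esub> free_gen K x)"
  shows "P f"
proof -
  interpret cring K by fact
  \<comment> \<open>The set \<open>S\<close> only has to contain the support. If the coefficient at
    the new point vanishes, the induction hypothesis applies to \<open>f\<close> itself.\<close>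
  have "P f" if "finite S" "f \<in> carrier (free_space K X)" "{x. f x \<noteq> \<zero>\<^bsub>K\<^esub>} \<subseteq> S" for S f
    using that
  proof (induction S arbitrary: f rule: finite_induct)
    case empty
    then have "f = (\<lambda>x. \<zero>\<^bsub>K\<^esub>)" by auto
    with zero show ?case by simp
  next
    case (insert x S)
    show ?case
    proof (cases "f x = \<zero>\<^bsub>K\<^esub>")
      case True
      with insert.prems have "{x. f x \<noteq> \<zero>\<^bsub>K\<^esub>} \<subseteq> S" by auto
      with insert.IH insert.prems show ?thesis by blast
    next
      case False
      with insert.prems have x: "x \<in> X" by (auto simp: free_space_carrier)
      \<comment> \<open>Erasing the coefficient at \<open>x\<close> moves the support into
        \<open>S\<close>; adding \<open>f x\<close> times the generator at \<open>x\<close> restores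
        \<open>f\<close>.\<close>
      define g where "g = f(x := \<zero>\<^bsub>K\<^esub>)"
      have "{x. g x \<noteq> \<zero>\<^bsub>K\<^esub>} \<subseteq> {x. f x \<noteq> \<zero>\<^bsub>K\<^esub>}" by (auto simp: g_def)
      with insert.prems have g: "g \<in> carrier (free_space K X)"
        by (auto simp: free_space_carrier g_def intro: finite_subset)
      have "{x. g x \<noteq> \<zero>\<^bsub>K\<^esub>} \<subseteq> S" using insert.prems by (auto simp: g_def)
      with insert.IH g have "P g" by blast
      have "f = g \<oplus>\<^bsub>free_space K X\<^esub> f x \<odot>\<^bsub>free_space K X\<^esub> free_gen K x"
        using free_space_coeff[OF K insert.prems(1)]
        by (auto simp: g_def free_gen_def fun_eq_iff)
      with add[OF g \<open>P g\<close> free_space_coeff[OF K insert.prems(1)] x, of x]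
      show ?thesis by simp
    qed
  qed
  then show ?thesis using f by (auto simp: free_space_carrier)
qed

text \<open>The linear extension of \<open>b\<close> from generators to the free module. For
  \<open>b\<close> on pairs it is the sum that \<open>tensor_lift\<close> evaluates on
  representatives.\<close>

definition free_lift ::
  "('k, 'm) ring_scheme \<Rightarrow> ('k, 'u, 'n) module_scheme \<Rightarrow> ('x \<Rightarrow> 'u) \<Rightarrow> ('x \<Rightarrow> 'k) \<Rightarrow> 'u" where
  "free_lift K U b f = (\<Oplus>\<^bsub>U\<^esub>x\<in>{x. f x \<noteq> \<zero>\<^bsub>K\<^esub>}. f x \<odot>\<^bsub>U\<^esub> b x)"

text \<open>The added terms have coefficient zero. This lets sums for functions with different
  supports be compared over one index set; \<open>S \<subseteq> X\<close> keeps the values of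
  \<open>b\<close> in the carrier.\<close>

lemma free_lift_superset:
  assumes "module K U" and b: "b \<in> X \<rightarrow> carrier U" and f: "f \<in> carrier (free_space K X)"
    and S: "finite S" "{x. f x \<noteq> \<zero>\<^bsub>K\<^esub>} \<subseteq> S" "S \<subseteq> X"
  shows "free_lift K U b f = (\<Oplus>\<^bsub>U\<^esub>x\<in>S. f x \<odot>\<^bsub>U\<^esub> b x)"
proof -
  interpret module K U by fact
  show ?thesis
    unfolding free_lift_def
    by (rule M.add.finprod_mono_neutral_cong_left)
       (use S b free_space_coeff[OF R.is_cring f] in \<open>auto simp: Pi_iff\<close>)
qed

lemma free_lift_hom:
  assumes "module K U" and b: "b \<in> X \<rightarrow> carrier U"
  shows "free_lift K U b \<in> module_hom K (free_space K X) U"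
proof -
  interpret module K U by fact
  interpret F: module K "free_space K X" by (rule module_free_space[OF R.is_cring])
  note coeff = free_space_coeff[OF R.is_cring]
  note sup = free_lift_superset[OF assms]
  have supp: "finite {x. f x \<noteq> \<zero>\<^bsub>K\<^esub>}" "{x. f x \<noteq> \<zero>\<^bsub>K\<^esub>} \<subseteq> X"
    if "f \<in> carrier (free_space K X)" for f
    using that by (auto simp: free_space_carrier)
  have bx: "b x \<in> carrier U" if "x \<in> X" for x using b that by auto
  show ?thesis
  proof (rule module_homI)
    fix f assume f: "f \<in> carrier (free_space K X)"
    show "free_lift K U b f \<in> carrier U"
      unfolding free_lift_def using supp[OF f] coeff[OF f] bx
      by (intro M.finsum_closed) auto
    fix c assume c: "c \<in> carrier K"
    \<comment> \<open>The support of the multiple may be smaller, for instance when \<open>c\<close>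
      is zero, so both sums are taken over the support of \<open>f\<close>.\<close>
    let ?S = "{x. f x \<noteq> \<zero>\<^bsub>K\<^esub>}"
    have "free_lift K U b (c \<odot>\<^bsub>free_space K X\<^esub> f) = (\<Oplus>\<^bsub>U\<^esub>x\<in>?S. (c \<otimes>\<^bsub>K\<^esub> f x) \<odot>\<^bsub>U\<^esub> b x)"
    proof -
      have "{x. c \<otimes>\<^bsub>K\<^esub> f x \<noteq> \<zero>\<^bsub>K\<^esub>} \<subseteq> ?S" using c by auto
      then show ?thesis using sup[OF F.smult_closed[OF c f], of ?S] supp[OF f] by simp
    qed
    also have "\<dots> = (\<Oplus>\<^bsub>U\<^esub>x\<in>?S. c \<odot>\<^bsub>U\<^esub> (f x \<odot>\<^bsub>U\<^esub> b x))"
      using supp[OF f] coeff[OF f] bx c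
      by (intro M.finsum_cong') (auto simp: smult_assoc1)
    also have "\<dots> = c \<odot>\<^bsub>U\<^esub> free_lift K U b f"
      unfolding free_lift_def using supp[OF f] coeff[OF f] bx c
      by (intro finsum_smult[symmetric]) auto
    finally show "free_lift K U b (c \<odot>\<^bsub>free_space K X\<^esub> f) = c \<odot>\<^bsub>U\<^esub> free_lift K U b f" .
  next
    fix f g assume f: "f \<in> carrier (free_space K X)" and g: "g \<in> carrier (free_space K X)"
    \<comment> \<open>Cancellation can shrink the support of the sum; the union of the two supports
      serves all three functions.\<close>
    let ?S = "{x. f x \<noteq> \<zero>\<^bsub>K\<^esub>} \<union> {x. g x \<noteq> \<zero>\<^bsub>K\<^esub>}"
    have S: "finite ?S" "?S \<subseteq> X" using supp[OF f] supp[OF g] by auto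
    have "free_lift K U b (f \<oplus>\<^bsub>free_space K X\<^esub> g) = (\<Oplus>\<^bsub>U\<^esub>x\<in>?S. (f x \<oplus>\<^bsub>K\<^esub> g x) \<odot>\<^bsub>U\<^esub> b x)"
    proof -
      have "{x. f x \<oplus>\<^bsub>K\<^esub> g x \<noteq> \<zero>\<^bsub>K\<^esub>} \<subseteq> ?S" by auto
      then show ?thesis using sup[OF F.a_closed[OF f g], of ?S] S by simp
    qed
    also have "\<dots> = (\<Oplus>\<^bsub>U\<^esub>x\<in>?S. f x \<odot>\<^bsub>U\<^esub> b x \<oplus>\<^bsub>U\<^esub> g x \<odot>\<^bsub>U\<^esub> b x)"
      using S coeff[OF f] coeff[OF g] bx
      by (intro M.finsum_cong') (auto simp: smult_l_distr)
    also have "\<dots> = (\<Oplus>\<^bsub>U\<^esub>x\<in>?S. f x \<odot>\<^bsub>U\<^esub> b x) \<oplus>\<^bsub>U\<^esub> (\<Oplus>\<^bsub>U\<^esub>x\<in>?S. g x \<odot>\<^bsub>U\<^esub> b x)"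
      using S coeff[OF f] coeff[OF g] bx by (intro M.finsum_addf) auto
    also have "\<dots> = free_lift K U b f \<oplus>\<^bsub>U\<^esub> free_lift K U b g"
      using sup[OF f, of ?S] sup[OF g, of ?S] S by auto
    finally show "free_lift K U b (f \<oplus>\<^bsub>free_space K X\<^esub> g) = free_lift K U b f \<oplus>\<^bsub>U\<^esub> free_lift K U b g" .
  qed
qed

lemma free_lift_gen:
  assumes "module K U" and b: "b \<in> X \<rightarrow> carrier U" and x: "x \<in> X"
  shows "free_lift K U b (free_gen K x) = b x"
proof -
  interpret module K U by fact
  have bx: "b x \<in> carrier U" using b x by auto
  \<comment> \<open>Summing over \<open>{x}\<close> instead of the support also covers a ring with
    \<open>1 = 0\<close>, where the support of the generator is empty.\<close>
  have "free_lift K U b (free_gen K x) = (\<Oplus>\<^bsub>U\<^esub>y\<in>{x}. free_gen K x y \<odot>\<^bsub>U\<^esub> b y)"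
    using x by (intro free_lift_superset[OF assms(1) b free_gen_closed[OF R.is_cring x]])
      (auto simp: free_gen_def)
  also have "\<dots> = b x"
    using bx by (simp add: free_gen_def)
  finally show ?thesis .
qed

subsection \<open>Quotient modules\<close>

text \<open>Opens the calculus of additive cosets for submodules. Closure under negation follows
  from closure under scaling by \<open>- 1\<close>.\<close>

lemma abelian_subgroup_submodule:
  assumes "submodule K H V"
  shows "abelian_subgroup H V"
proof -
  interpret submodule K H V by fact
  interpret V: module K V by (rule module)
  have neg: "\<ominus>\<^bsub>V\<^esub> x \<in> H" if "x \<in> H" for x
  proof -
    have "x \<in> carrier V" using that subset by auto
    then have "\<ominus>\<^bsub>V\<^esub> x = (\<ominus>\<^bsub>K\<^esub> \<one>\<^bsub>K\<^esub>) \<odot>\<^bsub>V\<^esub> x"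
      using V.smult_l_minus[of "\<one>\<^bsub>K\<^esub>" x] by simp
    then show ?thesis using that by simp
  qed
  have "H \<noteq> {}" using zero_closed by blast
  then have "additive_subgroup H V"
    by (intro additive_subgroupI V.add.subgroupI)
       (use subset neg m_closed in \<open>auto simp: a_inv_def\<close>)
  then show ?thesis by (rule abelian_subgroupI3) (rule V.M.abelian_group_axioms)
qed

lemma quotient_space_carrier: "carrier (quotient_space V H) = (\<lambda>x. H +>\<^bsub>V\<^esub> x) ` carrier V"
  by (auto simp: quotient_space_def A_RCOSETS_def' a_r_coset_def')

text \<open>The zero is defined as \<open>H\<close>; written as the coset of zero it has the shape
  on which the rules for sums and multiples of cosets act.\<close>

lemma quotient_space_zero:
  assumes "submodule K H V"
  shows "\<zero>\<^bsub>quotient_space V H\<^esub> = H +>\<^bsub>V\<^esub> \<zero>\<^bsub>V\<^esub>"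
proof -
  interpret abelian_subgroup H V by (rule abelian_subgroup_submodule[OF assms])
  show ?thesis by (simp add: quotient_space_def a_coset_add_zero[OF a_subset])
qed

lemma quotient_space_add:
  assumes "submodule K H V" and "x \<in> carrier V" and "y \<in> carrier V"
  shows "(H +>\<^bsub>V\<^esub> x) \<oplus>\<^bsub>quotient_space V H\<^esub> (H +>\<^bsub>V\<^esub> y) = H +>\<^bsub>V\<^esub> (x \<oplus>\<^bsub>V\<^esub> y)"
proof -
  interpret abelian_subgroup H V by (rule abelian_subgroup_submodule[OF assms(1)])
  show ?thesis using a_rcos_sum assms by (simp add: quotient_space_def)
qed

text \<open>The union in \<open>quotient_space\<close> runs over all representatives
  \<open>h + x\<close>. Since \<open>c h\<close> lies in \<open>H\<close>, they all give the same
  coset, and a nonempty union of equal sets is that set.\<close>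

lemma quotient_space_smult:
  assumes "submodule K H V" and c: "c \<in> carrier K" and x: "x \<in> carrier V"
  shows "c \<odot>\<^bsub>quotient_space V H\<^esub> (H +>\<^bsub>V\<^esub> x) = H +>\<^bsub>V\<^esub> (c \<odot>\<^bsub>V\<^esub> x)"
proof -
  interpret abelian_subgroup H V by (rule abelian_subgroup_submodule[OF assms(1)])
  interpret submodule K H V by fact
  interpret V: module K V by (rule module)
  have "H +>\<^bsub>V\<^esub> (c \<odot>\<^bsub>V\<^esub> y) = H +>\<^bsub>V\<^esub> (c \<odot>\<^bsub>V\<^esub> x)" if y: "y \<in> H +>\<^bsub>V\<^esub> x" for y
  proof -
    obtain h where h: "h \<in> H" "y = h \<oplus>\<^bsub>V\<^esub> x" using y by (auto simp: a_r_coset_def')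
    then have "c \<odot>\<^bsub>V\<^esub> y = c \<odot>\<^bsub>V\<^esub> h \<oplus>\<^bsub>V\<^esub> c \<odot>\<^bsub>V\<^esub> x"
      using c x by (simp add: V.smult_r_distr)
    then have "c \<odot>\<^bsub>V\<^esub> y \<in> H +>\<^bsub>V\<^esub> (c \<odot>\<^bsub>V\<^esub> x)"
      using h c by (auto simp: a_r_coset_def')
    then show ?thesis using c x by (metis a_repr_independence' V.smult_closed)
  qed
  moreover have "H +>\<^bsub>V\<^esub> x \<noteq> {}" using a_rcos_self[OF x] by blast
  ultimately have "(\<Union>y\<in>H +>\<^bsub>V\<^esub> x. H +>\<^bsub>V\<^esub> (c \<odot>\<^bsub>V\<^esub> y)) = H +>\<^bsub>V\<^esub> (c \<odot>\<^bsub>V\<^esub> x)"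
    by (intro SUP_eq_const)
  then show ?thesis by (simp add: quotient_space_def)
qed

lemma module_quotient_space:
  assumes "submodule K H V"
  shows "module K (quotient_space V H)"
proof -
  interpret V: module K V by (rule submodule.module[OF assms])
  note simps = quotient_space_carrier quotient_space_zero[OF assms] quotient_space_add[OF assms]
    quotient_space_smult[OF assms]
  have neg: "\<exists>y\<in>carrier V. H +>\<^bsub>V\<^esub> (x \<oplus>\<^bsub>V\<^esub> y) = H +>\<^bsub>V\<^esub> \<zero>\<^bsub>V\<^esub>" if "x \<in> carrier V" for x
    using that by (intro bexI[of _ "\<ominus>\<^bsub>V\<^esub> x"]) (auto simp: V.r_neg)
  show ?thesis
    by (rule module_criteria)
       (use neg in \<open>auto simp: simps V.R.is_cring V.M.add.m_lcomm V.M.a_comm V.M.a_assoc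
         V.smult_l_distr V.smult_r_distr V.smult_assoc1\<close>)
qed

lemma quotient_map_hom:
  assumes "submodule K H V"
  shows "(\<lambda>x. H +>\<^bsub>V\<^esub> x) \<in> module_hom K V (quotient_space V H)"
  by (rule module_homI)
     (simp_all add: quotient_space_carrier quotient_space_add[OF assms] quotient_space_smult[OF assms])

lemma quotient_map_eqI:
  assumes "submodule K H V" and x: "x \<in> carrier V" and y: "y \<in> carrier V"
    and "x \<ominus>\<^bsub>V\<^esub> y \<in> H"
  shows "H +>\<^bsub>V\<^esub> x = H +>\<^bsub>V\<^esub> y"
proof -
  interpret abelian_subgroup H V by (rule abelian_subgroup_submodule[OF assms(1)])
  have "x \<in> H +>\<^bsub>V\<^esub> y"
    using assms(4) by (intro a_rcos_module_rev[OF y x]) (simp add: a_minus_def)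
  then show ?thesis using y by (metis a_repr_independence')
qed

text \<open>A representative differs from \<open>x\<close> by an element that \<open>g\<close>
  kills. Hence the image of a coset is a singleton, as \<open>the_elem\<close> in
  \<open>tensor_lift\<close> requires.\<close>

lemma module_hom_constant_on_coset:
  assumes H: "submodule K H V" and U: "module K U" and g: "g \<in> module_hom K V U"
    and kill: "\<And>h. h \<in> H \<Longrightarrow> g h = \<zero>\<^bsub>U\<^esub>" and x: "x \<in> carrier V" and y: "y \<in> H +>\<^bsub>V\<^esub> x"
  shows "g y = g x"
proof -
  interpret U: module K U by fact
  obtain h where h: "h \<in> H" "y = h \<oplus>\<^bsub>V\<^esub> x" using y by (auto simp: a_r_coset_def')
  then have "h \<in> carrier V" using submodule.subset[OF H] by auto
  with h x show ?thesis by (simp add: module_hom_simps[OF g] kill)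
qed

subsection \<open>Bilinear maps and the universal property of the tensor product\<close>

text \<open>Phrasing bilinearity through the two families of partial maps reduces composition with
  linear maps to \<open>module_hom_comp\<close>.\<close>

definition bilinear_map ::
  "('k, 'm) ring_scheme \<Rightarrow> ('k, 'v, 'n) module_scheme \<Rightarrow> ('k, 'w, 'p) module_scheme
    \<Rightarrow> ('k, 'u, 'q) module_scheme \<Rightarrow> ('v \<Rightarrow> 'w \<Rightarrow> 'u) \<Rightarrow> bool" where
  "bilinear_map K V W U b \<longleftrightarrow>
     (\<forall>x\<in>carrier V. b x \<in> module_hom K W U) \<and> (\<forall>y\<in>carrier W. (\<lambda>x. b x y) \<in> module_hom K V U)"

lemma bilinear_map_left: "\<lbrakk>bilinear_map K V W U b; y \<in> carrier W\<rbrakk> \<Longrightarrow> (\<lambda>x. b x y) \<in> module_hom K V U"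
  and bilinear_map_right: "\<lbrakk>bilinear_map K V W U b; x \<in> carrier V\<rbrakk> \<Longrightarrow> b x \<in> module_hom K W U"
  by (auto simp: bilinear_map_def)

lemma bilinear_map_closed:
  "\<lbrakk>bilinear_map K V W U b; x \<in> carrier V; y \<in> carrier W\<rbrakk> \<Longrightarrow> b x y \<in> carrier U"
  by (rule module_hom_in_carrier[OF bilinear_map_right])

lemma bilinear_map_precomp:
  assumes "bilinear_map K V W U b" and f: "f \<in> module_hom K V' V" and g: "g \<in> module_hom K W' W"
  shows "bilinear_map K V' W' U (\<lambda>x y. b (f x) (g y))"
  unfolding bilinear_map_def
proof safe
  fix x assume "x \<in> carrier V'"
  with module_hom_comp[OF g bilinear_map_right[OF assms(1), of "f x"]]
  show "(\<lambda>y. b (f x) (g y)) \<in> module_hom K W' U"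
    by (simp add: module_hom_in_carrier[OF f] comp_def)
next
  fix y assume "y \<in> carrier W'"
  with module_hom_comp[OF f bilinear_map_left[OF assms(1), of "g y"]]
  show "(\<lambda>x. b (f x) (g y)) \<in> module_hom K V' U"
    by (simp add: module_hom_in_carrier[OF g] comp_def)
qed

lemma bilinear_map_postcomp:
  assumes "bilinear_map K V W U b" and "h \<in> module_hom K U U'"
  shows "bilinear_map K V W U' (\<lambda>x y. h (b x y))"
  using module_hom_comp[OF bilinear_map_left[OF assms(1)] assms(2)]
    module_hom_comp[OF bilinear_map_right[OF assms(1)] assms(2)]
  by (auto simp: bilinear_map_def comp_def)

locale tensor_factors = V: module K V + W: module K W
  for K :: "('k, 'm) ring_scheme" and V :: "('k, 'v, 'n) module_scheme"
    and W :: "('k, 'w, 'p) module_scheme"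
begin

abbreviation "F \<equiv> free_space K (carrier V \<times> carrier W)"
abbreviation "N \<equiv> tensor_null K V W"
abbreviation "T \<equiv> tensor_space K V W"

lemma gen_closed: "x \<in> carrier V \<Longrightarrow> y \<in> carrier W \<Longrightarrow> free_gen K (x, y) \<in> carrier F"
  by (rule free_gen_closed[OF V.R.is_cring]) simp

sublocale F: module K F
  by (rule module_free_space[OF V.R.is_cring])

section \<open>Defining relations, bilinearity of pure tensors, and generation by pure
  tensors\<close>

lemma tensor_relationsI:
  "\<lbrakk>x \<in> carrier V; x' \<in> carrier V; y \<in> carrier W\<rbrakk> \<Longrightarrow> free_gen K (x \<oplus>\<^bsub>V\<^esub> x', y) \<ominus>\<^bsub>F\<^esub>
    (free_gen K (x, y) \<oplus>\<^bsub>F\<^esub> free_gen K (x', y)) \<in> tensor_relations K V W"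
  "\<lbrakk>x \<in> carrier V; y \<in> carrier W; y' \<in> carrier W\<rbrakk> \<Longrightarrow> free_gen K (x, y \<oplus>\<^bsub>W\<^esub> y') \<ominus>\<^bsub>F\<^esub>
    (free_gen K (x, y) \<oplus>\<^bsub>F\<^esub> free_gen K (x, y')) \<in> tensor_relations K V W"
  "\<lbrakk>c \<in> carrier K; x \<in> carrier V; y \<in> carrier W\<rbrakk> \<Longrightarrow>
    free_gen K (c \<odot>\<^bsub>V\<^esub> x, y) \<ominus>\<^bsub>F\<^esub> c \<odot>\<^bsub>F\<^esub> free_gen K (x, y) \<in> tensor_relations K V W"
  "\<lbrakk>c \<in> carrier K; x \<in> carrier V; y \<in> carrier W\<rbrakk> \<Longrightarrow>
    free_gen K (x, c \<odot>\<^bsub>W\<^esub> y) \<ominus>\<^bsub>F\<^esub> c \<odot>\<^bsub>F\<^esub> free_gen K (x, y) \<in> tensor_relations K V W"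
  unfolding tensor_relations_def Let_def by blast+

lemma tensor_relations_subset: "tensor_relations K V W \<subseteq> carrier F"
  unfolding tensor_relations_def Let_def
  by (auto simp del: free_space_simps intro!: F.M.minus_closed gen_closed F.M.a_closed F.smult_closed)

lemma submodule_tensor_null: "submodule K N F"
  unfolding tensor_null_def by (rule F.span_is_submodule[OF tensor_relations_subset])

lemma tensor_relations_null: "tensor_relations K V W \<subseteq> N"
  unfolding tensor_null_def by (rule F.in_own_span[OF tensor_relations_subset])

lemma module_tensor_space: "module K T"
  unfolding tensor_space_def by (rule module_quotient_space[OF submodule_tensor_null])

lemma tensor_quotient_hom: "(\<lambda>f. N +>\<^bsub>F\<^esub> f) \<in> module_hom K F T"
  unfolding tensor_space_def by (rule quotient_map_hom[OF submodule_tensor_null])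

text \<open>The four families of relations are the differences of the two sides of additivity and
  homogeneity in each argument, and they lie in \<open>N\<close>.\<close>

lemma bilinear_pure_tensor: "bilinear_map K V W T (pure_tensor K V W)"
proof -
  note q = module_hom_simps[OF tensor_quotient_hom]
  note eqI = quotient_map_eqI[OF submodule_tensor_null _ _ subsetD[OF tensor_relations_null]]
  \<comment> \<open>Unfolding the operations of \<open>F\<close> pointwise would hide the module
    expressions that the relations and the linearity rules match.\<close>
  note [simp del] = free_space_simps
  show ?thesis
    unfolding bilinear_map_def
  proof (intro conjI ballI module_homI)
    fix x y assume x: "x \<in> carrier V" and y: "y \<in> carrier W"
    \<comment> \<open>The same goal arises twice, once for each partial map.\<close>
    show "pure_tensor K V W x y \<in> carrier T" "pure_tensor K V W x y \<in> carrier T"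
      unfolding pure_tensor_def by (rule q(1)[OF gen_closed[OF x y]])+
    fix c assume c: "c \<in> carrier K"
    \<comment> \<open>Linearity of the quotient map, read backwards, turns the right side into a
      single coset; the two representatives then differ by a relation. The remaining goals go the
      same way.\<close>
    show "pure_tensor K V W x (c \<odot>\<^bsub>W\<^esub> y) = c \<odot>\<^bsub>T\<^esub> pure_tensor K V W x y"
      unfolding pure_tensor_def q(3)[OF c gen_closed[OF x y], symmetric]
      by (rule eqI) (simp_all add: x y c gen_closed tensor_relationsI)
    show "pure_tensor K V W (c \<odot>\<^bsub>V\<^esub> x) y = c \<odot>\<^bsub>T\<^esub> pure_tensor K V W x y"
      unfolding pure_tensor_def q(3)[OF c gen_closed[OF x y], symmetric]
      by (rule eqI) (simp_all add: x y c gen_closed tensor_relationsI)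
  next
    fix x y y' assume x: "x \<in> carrier V" and y: "y \<in> carrier W" "y' \<in> carrier W"
    show "pure_tensor K V W x (y \<oplus>\<^bsub>W\<^esub> y') = pure_tensor K V W x y \<oplus>\<^bsub>T\<^esub> pure_tensor K V W x y'"
      unfolding pure_tensor_def q(2)[OF gen_closed[OF x y(1)] gen_closed[OF x y(2)], symmetric]
      by (rule eqI) (simp_all add: x y gen_closed tensor_relationsI)
  next
    fix x x' y assume x: "x \<in> carrier V" "x' \<in> carrier V" and y: "y \<in> carrier W"
    show "pure_tensor K V W (x \<oplus>\<^bsub>V\<^esub> x') y = pure_tensor K V W x y \<oplus>\<^bsub>T\<^esub> pure_tensor K V W x' y"
      unfolding pure_tensor_def q(2)[OF gen_closed[OF x(1) y] gen_closed[OF x(2) y], symmetric]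
      by (rule eqI) (simp_all add: x y gen_closed tensor_relationsI)
  qed
qed

text \<open>Every element is a class from the free module, and the linear quotient map sends
  generators to pure tensors, so \<open>free_space_induct\<close> descends.\<close>

lemma tensor_space_induct [consumes 1, case_names zero add]:
  assumes X: "X \<in> carrier T" and zero: "P \<zero>\<^bsub>T\<^esub>"
    and add: "\<And>X c x y. \<lbrakk>X \<in> carrier T; P X; c \<in> carrier K; x \<in> carrier V; y \<in> carrier W\<rbrakk> \<Longrightarrow>
      P (X \<oplus>\<^bsub>T\<^esub> c \<odot>\<^bsub>T\<^esub> pure_tensor K V W x y)"
  shows "P X"
proof -
  note q = module_hom_simps[OF tensor_quotient_hom]
  note [simp del] = free_space_simps
  have "P (N +>\<^bsub>F\<^esub> f)" if "f \<in> carrier F" for f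
    using V.R.is_cring that
  proof (induction rule: free_space_induct)
    case zero
    show ?case
      using \<open>P \<zero>\<^bsub>T\<^esub>\<close> quotient_space_zero[OF submodule_tensor_null] by (simp add: tensor_space_def)
  next
    case (add f c p)
    obtain x y where p: "p = (x, y)" "x \<in> carrier V" "y \<in> carrier W" using add by auto
    have "N +>\<^bsub>F\<^esub> (f \<oplus>\<^bsub>F\<^esub> c \<odot>\<^bsub>F\<^esub> free_gen K p)
        = (N +>\<^bsub>F\<^esub> f) \<oplus>\<^bsub>T\<^esub> c \<odot>\<^bsub>T\<^esub> pure_tensor K V W x y"
      using add.hyps p by (simp add: q gen_closed pure_tensor_def)
    with assms(3)[of "N +>\<^bsub>F\<^esub> f" c x y] add p q(1) show ?case by simp
  qed
  moreover obtain f where "f \<in> carrier F" "X = N +>\<^bsub>F\<^esub> f"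
    using X by (auto simp: tensor_space_def quotient_space_carrier)
  ultimately show ?thesis by simp
qed

text \<open>The uniqueness half of the universal property: agreement on pure tensors passes to
  multiples and sums, hence to everything they generate.\<close>

lemma tensor_hom_eqI:
  assumes U: "module K U" and g: "g \<in> module_hom K T U" and h: "h \<in> module_hom K T U"
    and pure: "\<And>x y. \<lbrakk>x \<in> carrier V; y \<in> carrier W\<rbrakk> \<Longrightarrow>
      g (pure_tensor K V W x y) = h (pure_tensor K V W x y)"
    and X: "X \<in> carrier T"
  shows "g X = h X"
proof -
  interpret T: module K T by (rule module_tensor_space)
  show ?thesis
    using X
  proof (induction rule: tensor_space_induct)
    case zero
    show ?case
      by (simp add: module_hom_zero[OF T.module_axioms U g] module_hom_zero[OF T.module_axioms U h])
  next
    case (add X c x y)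
    note p = bilinear_map_closed[OF bilinear_pure_tensor add.hyps(3,4)]
    show ?case
      unfolding module_hom_add[OF g add.hyps(1) T.smult_closed[OF add.hyps(2) p]]
        module_hom_add[OF h add.hyps(1) T.smult_closed[OF add.hyps(2) p]]
        module_hom_smult[OF g add.hyps(2) p] module_hom_smult[OF h add.hyps(2) p]
        pure[OF add.hyps(3,4)] add.IH ..
  qed
qed

section \<open>Existence half of the universal property\<close>

context
  fixes U :: "('k, 'u, 'q) module_scheme" and b
  assumes U: "module K U" and b: "bilinear_map K V W U b"
begin

interpretation U: module K U by (rule U)

private abbreviation "L \<equiv> free_lift K U (\<lambda>p. b (fst p) (snd p))"

private lemma lift_closed: "(\<lambda>p. b (fst p) (snd p)) \<in> carrier V \<times> carrier W \<rightarrow> carrier U"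
  by (auto intro: bilinear_map_closed[OF b])

private lemmas L_hom = free_lift_hom[OF U lift_closed]

private lemma L_gen: "\<lbrakk>x \<in> carrier V; y \<in> carrier W\<rbrakk> \<Longrightarrow> L (free_gen K (x, y)) = b x y"
  using free_lift_gen[OF U lift_closed, of "(x, y)"] by simp

text \<open>The kernel of \<open>L\<close> is a submodule, so it contains the span \<open>N\<close>
  once it contains the relations; these die because \<open>b\<close> is bilinear.\<close>

private lemma L_null:
  assumes "f \<in> N"
  shows "L f = \<zero>\<^bsub>U\<^esub>"
proof -
  interpret L: mod_hom K F U L
    using L_hom U F.module_axioms by (intro mod_hom.intro mod_hom_axioms.intro)
  note [simp del] = free_space_simps
  \<comment> \<open>This reduces membership of a relation in the kernel to an equation between
    values of \<open>L\<close>, which bilinearity of \<open>b\<close> settles.\<close>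
  have diff: "f \<ominus>\<^bsub>F\<^esub> g \<in> L.ker" if "f \<in> carrier F" "g \<in> carrier F" "L f = L g" for f g
  proof -
    have "L (f \<ominus>\<^bsub>F\<^esub> g) = \<zero>\<^bsub>U\<^esub>"
      unfolding module_hom_minus[OF F.module_axioms U L_hom that(1,2)] that(3)
      by (simp add: a_minus_def U.M.r_neg module_hom_in_carrier[OF L_hom that(2)])
    then show ?thesis
      unfolding L.ker_def using F.M.minus_closed[OF that(1,2)] by blast
  qed
  note bl = module_hom_simps[OF bilinear_map_left[OF b]] module_hom_simps[OF bilinear_map_right[OF b]]
  have r1: "free_gen K (x \<oplus>\<^bsub>V\<^esub> x', y) \<ominus>\<^bsub>F\<^esub> (free_gen K (x, y) \<oplus>\<^bsub>F\<^esub> free_gen K (x', y)) \<in> L.ker"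
    if "x \<in> carrier V" "x' \<in> carrier V" "y \<in> carrier W" for x x' y
    by (rule diff) (simp_all add: that gen_closed L_gen bl)
  have r2: "free_gen K (x, y \<oplus>\<^bsub>W\<^esub> y') \<ominus>\<^bsub>F\<^esub> (free_gen K (x, y) \<oplus>\<^bsub>F\<^esub> free_gen K (x, y')) \<in> L.ker"
    if "x \<in> carrier V" "y \<in> carrier W" "y' \<in> carrier W" for x y y'
    by (rule diff) (simp_all add: that gen_closed L_gen bl)
  have r3: "free_gen K (c \<odot>\<^bsub>V\<^esub> x, y) \<ominus>\<^bsub>F\<^esub> c \<odot>\<^bsub>F\<^esub> free_gen K (x, y) \<in> L.ker"
    if "c \<in> carrier K" "x \<in> carrier V" "y \<in> carrier W" for c x y
    by (rule diff) (simp_all add: that gen_closed L_gen bl)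
  have r4: "free_gen K (x, c \<odot>\<^bsub>W\<^esub> y) \<ominus>\<^bsub>F\<^esub> c \<odot>\<^bsub>F\<^esub> free_gen K (x, y) \<in> L.ker"
    if "c \<in> carrier K" "x \<in> carrier V" "y \<in> carrier W" for c x y
    by (rule diff) (simp_all add: that gen_closed L_gen bl)
  have "tensor_relations K V W \<subseteq> L.ker"
    unfolding tensor_relations_def Let_def
    by (intro Un_least subsetI; clarify; rule r1 r2 r3 r4; assumption)
  then have "N \<subseteq> L.ker"
    unfolding tensor_null_def by (rule F.span_is_subset[OF _ L.ker_is_submodule])
  then show ?thesis using assms L.f_ker by blast
qed

text \<open>\<open>L\<close> kills \<open>N\<close>, so it is constant on the coset, which is
  nonempty as it contains \<open>f\<close>; \<open>the_elem\<close> therefore returns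
  \<open>L f\<close>.\<close>

private lemma tensor_lift_coset:
  assumes f: "f \<in> carrier F"
  shows "tensor_lift K U b (N +>\<^bsub>F\<^esub> f) = L f"
proof -
  interpret N: abelian_subgroup N F
    by (rule abelian_subgroup_submodule[OF submodule_tensor_null])
  have "L ` (N +>\<^bsub>F\<^esub> f) = (\<lambda>_. L f) ` (N +>\<^bsub>F\<^esub> f)"
    by (intro image_cong refl module_hom_constant_on_coset[OF submodule_tensor_null U L_hom L_null f])
  also have "\<dots> = {L f}"
    by (rule image_constant[OF N.a_rcos_self[OF f]])
  finally show ?thesis
    by (simp add: tensor_lift_def free_lift_def)
qed

lemma tensor_lift_pure:
  assumes "x \<in> carrier V" and "y \<in> carrier W"
  shows "tensor_lift K U b (pure_tensor K V W x y) = b x y"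
  unfolding pure_tensor_def tensor_lift_coset[OF gen_closed[OF assms]] by (rule L_gen[OF assms])

text \<open>Linearity descends from \<open>L\<close>: sums and multiples of cosets are cosets of
  sums and multiples of representatives.\<close>

lemma tensor_lift_hom: "tensor_lift K U b \<in> module_hom K T U"
proof -
  note q = module_hom_simps[OF tensor_quotient_hom]
  note [simp del] = free_space_simps
  have rep: "\<exists>f\<in>carrier F. X = N +>\<^bsub>F\<^esub> f" if "X \<in> carrier T" for X
    using that by (auto simp: tensor_space_def quotient_space_carrier)
  show ?thesis
  proof (rule module_homI)
    fix X assume "X \<in> carrier T"
    then obtain f where f: "f \<in> carrier F" "X = N +>\<^bsub>F\<^esub> f" using rep by blast
    then show "tensor_lift K U b X \<in> carrier U"
      by (simp add: tensor_lift_coset module_hom_simps[OF L_hom])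
    fix c assume "c \<in> carrier K"
    with f show "tensor_lift K U b (c \<odot>\<^bsub>T\<^esub> X) = c \<odot>\<^bsub>U\<^esub> tensor_lift K U b X"
      by (simp add: q(3)[symmetric] tensor_lift_coset module_hom_simps[OF L_hom])
  next
    fix X Y assume "X \<in> carrier T" "Y \<in> carrier T"
    then obtain f g where "f \<in> carrier F" "X = N +>\<^bsub>F\<^esub> f" "g \<in> carrier F" "Y = N +>\<^bsub>F\<^esub> g"
      using rep by meson
    then show "tensor_lift K U b (X \<oplus>\<^bsub>T\<^esub> Y) = tensor_lift K U b X \<oplus>\<^bsub>U\<^esub> tensor_lift K U b Y"
      by (simp add: q(2)[symmetric] tensor_lift_coset module_hom_simps[OF L_hom])
  qed
qed

end

end

text \<open>Pure tensors precomposed with \<open>f\<close> and \<open>g\<close> form a bilinear map,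
  so both claims are instances of the universal property.\<close>

lemma
  assumes "tensor_factors K V W" and "tensor_factors K V' W'"
    and f: "f \<in> module_hom K V V'" and g: "g \<in> module_hom K W W'"
  shows tensor_map_hom:
      "tensor_map K V' W' f g \<in> module_hom K (tensor_space K V W) (tensor_space K V' W')"
    and tensor_map_pure: "\<lbrakk>x \<in> carrier V; y \<in> carrier W\<rbrakk> \<Longrightarrow>
      tensor_map K V' W' f g (pure_tensor K V W x y) = pure_tensor K V' W' (f x) (g y)"
proof -
  interpret A: tensor_factors K V W by fact
  interpret B: tensor_factors K V' W' by fact
  note b = bilinear_map_precomp[OF B.bilinear_pure_tensor f g]
  show "tensor_map K V' W' f g \<in> module_hom K (tensor_space K V W) (tensor_space K V' W')"
    unfolding tensor_map_def by (rule A.tensor_lift_hom[OF B.module_tensor_space b])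
  show "\<lbrakk>x \<in> carrier V; y \<in> carrier W\<rbrakk> \<Longrightarrow>
      tensor_map K V' W' f g (pure_tensor K V W x y) = pure_tensor K V' W' (f x) (g y)"
    unfolding tensor_map_def by (rule A.tensor_lift_pure[OF B.module_tensor_space b])
qed

subsection \<open>The derivation \<open>\<mu> \<circ> \<Delta>\<close>\<close>

text \<open>Multiplicativity is given on the carrier only; that of \<open>\<xi>\<close> applies to
  values of \<open>\<zeta>\<close> because linear maps preserve carriers.\<close>

lemma algebra_map_comp:
  assumes "algebra_map K A \<mu> \<xi>" and "algebra_map K A \<mu> \<zeta>"
  shows "algebra_map K A \<mu> (\<xi> \<circ> \<zeta>)"
  using assms module_hom_comp[of \<zeta> K A A \<xi> A] module_hom_in_carrier[of \<zeta> K A A]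
  by (auto simp: algebra_map_def multiplicative_def)

context bihom_associative_algebra
begin

sublocale AA: tensor_factors K A A
  by unfold_locales

lemma bilinear_alg_prod: "bilinear_map K A A A (alg_prod K A \<mu>)"
  using bilinear_map_postcomp[OF AA.bilinear_pure_tensor \<mu>_linear]
  by (simp add: alg_prod_def[abs_def])

text \<open>Passing the multiplier through \<open>\<mu>\<close> twists it by
  \<open>\<alpha>\<close>. With \<open>\<omega> a\<close> as multiplier this yields the factor
  \<open>\<alpha> (\<omega> a)\<close> of the derivation rule.\<close>

lemma \<mu>_tensor_map_left_mult:
  assumes a: "a \<in> carrier A" and X: "X \<in> carrier (tensor_space K A A)"
  shows "\<mu> (tensor_map K A A (\<lambda>x. alg_prod K A \<mu> a x) \<beta> X) = alg_prod K A \<mu> (\<alpha> a) (\<mu> X)"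
proof -
  note L = bilinear_map_right[OF bilinear_alg_prod]
  note \<alpha>a = module_hom_in_carrier[OF \<alpha>_linear a]
  \<comment> \<open>Both sides become composites, so that \<open>AA.tensor_hom_eqI\<close> can
    compare two linear maps at \<open>X\<close>.\<close>
  have "(\<mu> \<circ> tensor_map K A A (alg_prod K A \<mu> a) \<beta>) X = (alg_prod K A \<mu> (\<alpha> a) \<circ> \<mu>) X"
  proof (rule AA.tensor_hom_eqI[OF module_axioms _ _ _ X])
    show "\<mu> \<circ> tensor_map K A A (alg_prod K A \<mu> a) \<beta> \<in> module_hom K (tensor_space K A A) A"
      by (intro module_hom_comp[OF tensor_map_hom \<mu>_linear] AA.tensor_factors_axioms L[OF a] \<beta>_linear)
    show "alg_prod K A \<mu> (\<alpha> a) \<circ> \<mu> \<in> module_hom K (tensor_space K A A) A"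
      by (rule module_hom_comp[OF \<mu>_linear L[OF \<alpha>a]])
  next
    fix x y assume "x \<in> carrier A" "y \<in> carrier A"
    with bihom_assoc[OF a this] show "(\<mu> \<circ> tensor_map K A A (alg_prod K A \<mu> a) \<beta>) (pure_tensor K A A x y)
        = (alg_prod K A \<mu> (\<alpha> a) \<circ> \<mu>) (pure_tensor K A A x y)"
      by (simp add: tensor_map_pure[OF AA.tensor_factors_axioms AA.tensor_factors_axioms L[OF a] \<beta>_linear]
        alg_prod_def[of K A \<mu>, symmetric])
  qed
  then show ?thesis by simp
qed

text \<open>Here the fixed element is the third argument of \<open>bihom_assoc\<close> and gets
  twisted by \<open>\<beta>\<close>; the multiplier \<open>\<psi> b\<close> yields
  \<open>\<beta> (\<psi> b)\<close>.\<close>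

lemma \<mu>_tensor_map_right_mult:
  assumes b: "b \<in> carrier A" and X: "X \<in> carrier (tensor_space K A A)"
  shows "\<mu> (tensor_map K A A \<alpha> (\<lambda>y. alg_prod K A \<mu> y b) X) = alg_prod K A \<mu> (\<mu> X) (\<beta> b)"
proof -
  note R = bilinear_map_left[OF bilinear_alg_prod]
  note \<beta>b = module_hom_in_carrier[OF \<beta>_linear b]
  have "(\<mu> \<circ> tensor_map K A A \<alpha> (\<lambda>y. alg_prod K A \<mu> y b)) X = ((\<lambda>x. alg_prod K A \<mu> x (\<beta> b)) \<circ> \<mu>) X"
  proof (rule AA.tensor_hom_eqI[OF module_axioms _ _ _ X])
    show "\<mu> \<circ> tensor_map K A A \<alpha> (\<lambda>y. alg_prod K A \<mu> y b) \<in> module_hom K (tensor_space K A A) A"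
      by (intro module_hom_comp[OF tensor_map_hom \<mu>_linear] AA.tensor_factors_axioms R[OF b] \<alpha>_linear)
    show "(\<lambda>x. alg_prod K A \<mu> x (\<beta> b)) \<circ> \<mu> \<in> module_hom K (tensor_space K A A) A"
      by (rule module_hom_comp[OF \<mu>_linear R[OF \<beta>b]])
  next
    fix x y assume "x \<in> carrier A" "y \<in> carrier A"
    with bihom_assoc[OF this b] show "(\<mu> \<circ> tensor_map K A A \<alpha> (\<lambda>y. alg_prod K A \<mu> y b)) (pure_tensor K A A x y)
        = ((\<lambda>x. alg_prod K A \<mu> x (\<beta> b)) \<circ> \<mu>) (pure_tensor K A A x y)"
      by (simp add: tensor_map_pure[OF AA.tensor_factors_axioms AA.tensor_factors_axioms \<alpha>_linear R[OF b]]
        alg_prod_def[of K A \<mu>, symmetric])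
  qed
  then show ?thesis by simp
qed

end

text \<open>Apply \<open>\<mu>\<close> to \<open>\<Delta>_prod\<close> term by term: the two
  multiplication lemmas treat the first two summands, and on the pure tensor \<open>\<mu>\<close> is
  the product by definition.\<close>

lemma (in inf_bihom_bialgebra) \<mu>_\<Delta>_prod:
  assumes lam: "lam \<in> carrier K" and a: "a \<in> carrier A" and b: "b \<in> carrier A"
  shows "\<mu> (\<Delta> (alg_prod K A \<mu> a b)) =
      alg_prod K A \<mu> (\<alpha> (\<omega> a)) (\<mu> (\<Delta> b)) \<oplus>\<^bsub>A\<^esub> alg_prod K A \<mu> (\<mu> (\<Delta> a)) (\<beta> (\<psi> b))
      \<oplus>\<^bsub>A\<^esub> lam \<odot>\<^bsub>A\<^esub> alg_prod K A \<mu> (\<alpha> (\<omega> a)) (\<beta> (\<psi> b))"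
proof -
  interpret T: module K "tensor_space K A A" by (rule AA.module_tensor_space)
  note closed = module_hom_in_carrier[OF \<alpha>_linear] module_hom_in_carrier[OF \<beta>_linear]
    module_hom_in_carrier[OF \<psi>_linear] module_hom_in_carrier[OF \<omega>_linear]
    module_hom_in_carrier[OF \<Delta>_linear] bilinear_map_closed[OF AA.bilinear_pure_tensor]
  \<comment> \<open>Additivity of \<open>\<mu>\<close> holds for elements of the carrier, so the two
    \<open>tensor_map\<close> summands are first placed there.\<close>
  have "tensor_map K A A (\<lambda>x. alg_prod K A \<mu> (\<omega> a) x) \<beta> (\<Delta> b) \<in> carrier (tensor_space K A A)"
    using a b by (intro module_hom_in_carrier[OF tensor_map_hom[OF AA.tensor_factors_axioms AA.tensor_factors_axioms]] \<beta>_linear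
      bilinear_map_right[OF bilinear_alg_prod] closed)
  moreover have "tensor_map K A A \<alpha> (\<lambda>y. alg_prod K A \<mu> y (\<psi> b)) (\<Delta> a) \<in> carrier (tensor_space K A A)"
    using a b by (intro module_hom_in_carrier[OF tensor_map_hom[OF AA.tensor_factors_axioms AA.tensor_factors_axioms]] \<alpha>_linear
      bilinear_map_left[OF bilinear_alg_prod] closed)
  ultimately show ?thesis
    using lam a b
    by (simp add: \<Delta>_prod module_hom_simps[OF \<mu>_linear] closed \<mu>_tensor_map_left_mult
      \<mu>_tensor_map_right_mult alg_prod_def[of K A \<mu>, symmetric])
qed

theorem lemma3p4:
  fixes K :: "('k, 'm) ring_scheme" and A :: "('k, 'a, 'n) module_scheme"
    and \<mu> :: "('a \<times> 'a \<Rightarrow> 'k) set \<Rightarrow> 'a" and \<Delta> :: "'a \<Rightarrow> ('a \<times> 'a \<Rightarrow> 'k) set"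
    and \<alpha> \<beta> \<psi> \<omega> :: "'a \<Rightarrow> 'a" and lam :: 'k
  assumes "field K"
    and "lam \<in> carrier K"
    and "inf_bihom_bialgebra K A lam \<mu> \<Delta> \<alpha> \<beta> \<psi> \<omega>"
  shows "weighted_derivation K A \<mu> lam (\<alpha> \<circ> \<omega>) (\<beta> \<circ> \<psi>) (\<mu> \<circ> \<Delta>)"
proof -
  interpret inf_bihom_bialgebra K A lam \<mu> \<Delta> \<alpha> \<beta> \<psi> \<omega> by fact
  \<comment> \<open>\<open>weighted_derivation\<close> also asks that both twisting maps be algebra
    maps; they are composites of these four.\<close>
  have "algebra_map K A \<mu> \<alpha>" "algebra_map K A \<mu> \<beta>" "algebra_map K A \<mu> \<psi>" "algebra_map K A \<mu> \<omega>"
    using \<alpha>_linear \<beta>_linear \<psi>_linear \<omega>_linear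
      \<alpha>_multiplicative \<beta>_multiplicative \<psi>_multiplicative \<omega>_multiplicative
    by (simp_all add: algebra_map_def)
  then show ?thesis
    using module_hom_comp[OF \<Delta>_linear \<mu>_linear] \<mu>_\<Delta>_prod[OF assms(2)]
    by (simp add: weighted_derivation_def algebra_map_comp)
qed

end
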